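(* a) If $X\subseteq\mathbb{R}$, $\mathbf B$ is a base for a topology for $X$, and $\widehat{\mathbf B}:=\{m_{\approx}(A)\mid A\in\mathbf B\}$, then $\widehat{\mathbf B}$ is a base for a topology for $m_{\approx}(X)$. b) If $\mathbf T$ is a topology for $\mathbb{R}$ and $\widehat{\mathbf T}:=\{m_{\approx}(A)\mid A\in\mathbf T\}$, then $\widehat{\mathbf T}$ is a topology for $\widehat{\mathbb{R}}$. c) If $\mathbf T$ is a topology for $\mathbb{R}$, $\widehat{\mathbf T}:=\{m_{\approx}(A)\mid A\in\mathbf T\}$, and $X\subseteq\mathbb{R}$, then $$\mathrm{int}_{\widehat{\mathbf T}}m_{\approx}(X)=m_{\approx}(\mathrm{int}_{\mathbf T}X),\quad \mathrm{ext}_{\widehat{\mathbf T}}m_{\approx}(X)=m_{\approx}(\mathrm{ext}_{\mathbf T}X),$$ $$\mathrm{bd}_{\widehat{\mathbf T}}m_{\approx}(X)=m_{\approx}(\mathrm{bd}_{\mathbf T}X),\quad \mathrm{cl}_{\widehat{\mathbf T}}m_{\approx}(X)=m_{\approx}(\mathrm{cl}_{\mathbf T}X);$$ and $m_{\approx}(X)$ is open (respectively closed, compact) for $\widehat{\mathbf T}$ if and only if $X$ is open (respectively closed, compact) for $\mathbf T$. d) If $\mathbf T$ is a topology for $\mathbb{R}$, $\widehat{\mathbf T}:=\{m_{\approx}(A)\mid A\in\mathbf T\}$, $X\subseteq\mathbb{R}$ and $Y\subseteq X$, then $\widehat{\mathbf T}_{m_{\approx}(X)}=\{m_{\approx}(A)\mid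 A\in\mathbf T_X\}$ and $\mathrm{cl}_{\widehat{\mathbf T}_{m_{\approx}(X)}}m_{\approx}(Y)=m_{\approx}(\mathrm{cl}_{\mathbf T_X}Y)$, where $\widehat{\mathbf T}_{m_{\approx}(X)}$ and $\mathbf T_X$ are the relativizations of $\widehat{\mathbf T}$ and $\mathbf T$ to $m_{\approx}(X)$ and $X$, respectively. e) If $\mathbf T$ is a topology for $\mathbb{R}$, $\widehat{\mathbf T}:=\{m_{\approx}(A)\mid A\in\mathbf T\}$, and $X\subseteq\mathbb{R}$, then $m_{\approx}(X)$ is connected for $\widehat{\mathbf T}$ if and only if $X$ is connected for $\mathbf T$. f) If $\mathbf B$ is a $\sigma$-algebra of subsets of $\mathbb{R}$ and $\widehat{\mathbf B}:=\{m_{\approx}(A)\mid A\in\mathbf B\}$, then $\widehat{\mathbf B}$ is a $\sigma$-algebra of subsets of $\widehat{\mathbb{R}}$.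
   Context: $\widehat{\mathbb{R}}$ is the set of all convergent sequences of real numbers; a real number is identified with the corresponding constant sequence, so $\mathbb{R}\subseteq\widehat{\mathbb{R}}$. $\sigma x\in\mathbb{R}$ is the limit of $x$, and $x\approx y$ means $\sigma x=\sigma y$. For $\widehat A\subseteq\widehat{\mathbb{R}}$, the monad of $\widehat A$ is $m_{\approx}(\widehat A):=\{x\in\widehat{\mathbb{R}}\mid(\exists y\in\widehat A)\,x\approx y\}$. $\mathrm{int},\mathrm{ext},\mathrm{bd},\mathrm{cl}$ denote interior, exterior (interior of the complement), boundary and closure for the topology in the subscript. *)

theory Defs
  imports "HOL-Analysis.Analysis"
begin

definition conv_seqs :: "(nat \<Rightarrow> real) set" where
  "conv_seqs = {x. convergent x}"

text \<open>The identification of a real number with a constant sequence is made explicit.\<close>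
definition const_seq :: "real \<Rightarrow> nat \<Rightarrow> real" where
  "const_seq r = (\<lambda>n. r)"

definition approx_eq :: "(nat \<Rightarrow> real) \<Rightarrow> (nat \<Rightarrow> real) \<Rightarrow> bool" (infix "\<approx>\<^sub>R" 50) where
  "x \<approx>\<^sub>R y \<longleftrightarrow> x \<in> conv_seqs \<and> y \<in> conv_seqs \<and> lim x = lim y"

definition monad :: "(nat \<Rightarrow> real) set \<Rightarrow> (nat \<Rightarrow> real) set" where
  "monad A = {x \<in> conv_seqs. \<exists>y\<in>A. x \<approx>\<^sub>R y}"

abbreviation monad_real :: "real set \<Rightarrow> (nat \<Rightarrow> real) set" where
  "monad_real A \<equiv> monad (const_seq ` A)"

definition hat_family :: "real set set \<Rightarrow> (nat \<Rightarrow> real) set set" where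
  "hat_family \<A> = {monad_real A |A. A \<in> \<A>}"

text \<open>Membership of the empty set and of \<open>X\<close> in \<open>\<T>\<close> follows from closure under arbitrary unions,
  including the empty one, which is part of \<^const>\<open>istopology\<close>.\<close>
definition topology_for :: "'a set \<Rightarrow> 'a set set \<Rightarrow> bool" where
  "topology_for X \<T> \<longleftrightarrow> istopology (\<lambda>U. U \<in> \<T>) \<and> \<Union>\<T> = X"

text \<open>The topology value whose open sets are the members of \<open>\<T>\<close>; only meaningful when
  \<open>\<T>\<close> is a topology for some set.\<close>
definition topology_of :: "'a set set \<Rightarrow> 'a topology" where
  "topology_of \<T> = topology (\<lambda>U. U \<in> \<T>)"

definition base_for_topology :: "'a set \<Rightarrow> 'a set set \<Rightarrow> bool" where
  "base_for_topology X \<B> \<longleftrightarrow>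
     (\<exists>\<T>. topology_for X \<T> \<and> \<B> \<subseteq> \<T> \<and> (\<forall>U\<in>\<T>. \<exists>\<C>\<subseteq>\<B>. U = \<Union>\<C>))"

definition exterior_of :: "'a topology \<Rightarrow> 'a set \<Rightarrow> 'a set" (infixr "exterior'_of" 80) where
  "T exterior_of S = T interior_of (topspace T - S)"

end

theory Submission
  imports Defs
begin

text \<open>The monad of a set of reals \<open>A\<close> is the preimage of \<open>A\<close> under the surjection
  \<^const>\<open>lim\<close> from \<^const>\<open>conv_seqs\<close> to the reals. Hence it commutes with all set operations
  and reflects inclusion, and \<open>hat_family \<T>\<close> is the initial topology of \<open>lim\<close>: the open sets
  of the two topologies correspond one to one. Compactness and connectedness
  transfer along the continuous maps \<open>lim\<close> and \<open>const_seq\<close>, because no open set separates a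
  convergent sequence from its limit.\<close>

section \<open>The monad as a preimage\<close>

lemma const_seq_in_conv_seqs [simp]: "const_seq r \<in> conv_seqs"
  by (simp add: conv_seqs_def const_seq_def convergent_const)

lemma lim_const_seq [simp]: "lim (const_seq r) = r"
  by (simp add: const_seq_def)

text \<open>The only constant sequence that can witness \<open>x \<in> monad_real A\<close> is the
  one at \<open>lim x\<close>, so the existential in \<open>monad\<close> collapses.\<close>

lemma monad_real_eq: "monad_real A = lim -` A \<inter> conv_seqs"
  by (auto simp: monad_def approx_eq_def)

lemma in_monad_real_iff [simp]: "x \<in> monad_real A \<longleftrightarrow> x \<in> conv_seqs \<and> lim x \<in> A"
  by (auto simp: monad_real_eq)

lemma monad_real_UNIV: "monad_real UNIV = conv_seqs"
  by auto

lemma monad_real_Union: "\<Union>(monad_real ` \<A>) = monad_real (\<Union>\<A>)"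
  by auto

lemma monad_real_Int: "monad_real A \<inter> monad_real B = monad_real (A \<inter> B)"
  by auto

lemma monad_real_Diff: "monad_real A - monad_real B = monad_real (A - B)"
  by auto

text \<open>Constant sequences make \<open>lim\<close> surjective on \<open>conv_seqs\<close>, so
  preimages lose no information: \<open>const_seq r\<close> tests whether \<open>r\<close> lies in
  the set. Injectivity of \<open>monad_real\<close> follows.\<close>

lemma monad_real_subset_iff: "monad_real A \<subseteq> monad_real B \<longleftrightarrow> A \<subseteq> B"
proof
  assume sub: "monad_real A \<subseteq> monad_real B"
  show "A \<subseteq> B"
  proof
    fix r assume "r \<in> A"
    then have "const_seq r \<in> monad_real B"
      using sub by (intro subsetD[OF sub]) simp
    then show "r \<in> B" by simp
  qed
qed auto

lemma monad_real_eq_iff: "monad_real A = monad_real B \<longleftrightarrow> A = B"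
  by (metis monad_real_subset_iff subset_antisym subset_refl)

lemma lim_image_monad_real: "lim ` monad_real A = A"
proof
  show "A \<subseteq> lim ` monad_real A"
  proof
    fix r assume "r \<in> A"
    then show "r \<in> lim ` monad_real A"
      by (intro image_eqI[where x = "const_seq r"]) simp_all
  qed
qed auto

lemma hat_family_eq_image: "hat_family \<A> = monad_real ` \<A>"
  by (auto simp: hat_family_def)

lemma monad_real_in_hat_family_iff: "monad_real A \<in> hat_family \<A> \<longleftrightarrow> A \<in> \<A>"
  by (auto simp only: hat_family_eq_image image_iff monad_real_eq_iff)

section \<open>Topologies and bases\<close>

lemma topology_for_hat_family:
  assumes "topology_for X \<T>"
  shows "topology_for (monad_real X) (hat_family \<T>)"
proof -
  have inter: "A \<inter> B \<in> \<T>" if "A \<in> \<T>" "B \<in> \<T>" for A B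
    using assms that by (auto simp: topology_for_def istopology_def)
  have union: "\<Union>\<C> \<in> \<T>" if "\<C> \<subseteq> \<T>" for \<C>
    using assms that by (auto simp: topology_for_def istopology_def)
  have "\<Union>\<K> \<in> hat_family \<T>" if "\<K> \<subseteq> hat_family \<T>" for \<K>
  proof -
    \<comment> \<open>A family of monads is the image of a family of members of \<open>\<T>\<close>;
      the union is then taken among real sets, where closure is known.\<close>
    obtain \<C> where "\<C> \<subseteq> \<T>" "\<K> = monad_real ` \<C>"
      using \<open>\<K> \<subseteq> hat_family \<T>\<close> unfolding hat_family_eq_image subset_image_iff by blast
    then show ?thesis
      by (simp only: monad_real_Union monad_real_in_hat_family_iff union)
  qed
  moreover have "U \<inter> V \<in> hat_family \<T>" if U: "U \<in> hat_family \<T>" and V: "V \<in> hat_family \<T>" for U V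
  proof -
    obtain A B where "A \<in> \<T>" "U = monad_real A" "B \<in> \<T>" "V = monad_real B"
      using U V unfolding hat_family_eq_image by blast
    then show ?thesis
      by (simp only: monad_real_Int monad_real_in_hat_family_iff inter)
  qed
  ultimately have "istopology (\<lambda>U. U \<in> hat_family \<T>)"
    by (auto simp: istopology_def)
  moreover have "\<Union>(hat_family \<T>) = monad_real X"
    using assms by (simp only: topology_for_def hat_family_eq_image monad_real_Union)
  ultimately show ?thesis
    by (simp add: topology_for_def)
qed

text \<open>If the base generates \<open>\<T>\<close>, then \<open>hat_family \<T>\<close> is the
  required topology, since a union of base sets is carried to the union of their monads.\<close>

lemma base_for_topology_hat_family:
  assumes "base_for_topology X \<B>"
  shows "base_for_topology (monad_real X) (hat_family \<B>)"
proof -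
  obtain \<T> where top: "topology_for X \<T>" and sub: "\<B> \<subseteq> \<T>"
    and base: "\<forall>U\<in>\<T>. \<exists>\<C>\<subseteq>\<B>. U = \<Union>\<C>"
    using assms unfolding base_for_topology_def by (elim exE conjE)
  have "\<forall>U\<in>hat_family \<T>. \<exists>\<C>\<subseteq>hat_family \<B>. U = \<Union>\<C>"
  proof
    fix U assume "U \<in> hat_family \<T>"
    then obtain A where "A \<in> \<T>" and U: "U = monad_real A"
      unfolding hat_family_eq_image by blast
    then obtain \<C> where "\<C> \<subseteq> \<B>" "A = \<Union>\<C>"
      using base by (auto elim!: ballE)
    then have "monad_real ` \<C> \<subseteq> hat_family \<B>" "U = \<Union>(monad_real ` \<C>)"
      unfolding hat_family_eq_image U monad_real_Union by (simp_all only: image_mono)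
    then show "\<exists>\<C>\<subseteq>hat_family \<B>. U = \<Union>\<C>" by (intro exI conjI)
  qed
  moreover have "hat_family \<B> \<subseteq> hat_family \<T>"
    unfolding hat_family_eq_image by (rule image_mono[OF sub])
  ultimately show ?thesis
    unfolding base_for_topology_def using topology_for_hat_family[OF top]
    by (intro exI conjI)
qed

lemma openin_topology_of: "topology_for X \<T> \<Longrightarrow> openin (topology_of \<T>) U \<longleftrightarrow> U \<in> \<T>"
  by (simp add: topology_for_def topology_of_def topology_inverse')

lemma topspace_topology_of: "topology_for X \<T> \<Longrightarrow> topspace (topology_of \<T>) = X"
  by (auto simp: topspace_def openin_topology_of) (auto simp: topology_for_def)

section \<open>Transfer of topological notions\<close>

context
  fixes \<T> :: "real set set"
  assumes top: "topology_for UNIV \<T>"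
begin

lemma topology_for_conv_seqs: "topology_for conv_seqs (hat_family \<T>)"
  using topology_for_hat_family[OF top] by (simp only: monad_real_UNIV)

lemma topspace_real: "topspace (topology_of \<T>) = UNIV"
  using top by (rule topspace_topology_of)

text \<open>Writing \<open>conv_seqs\<close> as a monad lets complements and inclusions in the whole
  space be computed by \<open>monad_real_Diff\<close> and
  \<open>monad_real_subset_iff\<close>.\<close>

lemma topspace_hat: "topspace (topology_of (hat_family \<T>)) = monad_real UNIV"
  by (simp only: topspace_topology_of[OF topology_for_conv_seqs] monad_real_UNIV)

text \<open>This makes every open set saturated: it contains either all or none of the sequences
  with a given limit. The compactness and connectedness arguments rest on this.\<close>

lemma openin_hat_iff:
  "openin (topology_of (hat_family \<T>)) U \<longleftrightarrow> (\<exists>A. openin (topology_of \<T>) A \<and> U = monad_real A)"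
  unfolding openin_topology_of[OF top] openin_topology_of[OF topology_for_conv_seqs]
  by (auto simp: hat_family_def)

lemma openin_hat_monad_real:
  "openin (topology_of (hat_family \<T>)) (monad_real X) \<longleftrightarrow> openin (topology_of \<T>) X"
  by (auto simp only: openin_hat_iff monad_real_eq_iff)

lemma closedin_hat_monad_real:
  "closedin (topology_of (hat_family \<T>)) (monad_real X) \<longleftrightarrow> closedin (topology_of \<T>) X"
  by (simp only: closedin_def topspace_hat topspace_real monad_real_Diff openin_hat_monad_real
      monad_real_subset_iff)

section \<open>Interior, exterior, closure and boundary\<close>

lemma interior_of_hat:
  "topology_of (hat_family \<T>) interior_of (monad_real X) = monad_real (topology_of \<T> interior_of X)"
proof (rule interior_of_unique)
  show "monad_real (topology_of \<T> interior_of X) \<subseteq> monad_real X"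
    by (simp only: monad_real_subset_iff interior_of_subset)
  show "openin (topology_of (hat_family \<T>)) (monad_real (topology_of \<T> interior_of X))"
    by (simp only: openin_hat_monad_real openin_interior_of)
  \<comment> \<open>Maximality: an open competitor is itself the monad of some open
    \<open>A\<close>, and the inclusion descends to \<open>A \<subseteq> X\<close>.\<close>
  fix U assume sub: "U \<subseteq> monad_real X" and "openin (topology_of (hat_family \<T>)) U"
  then obtain A where "openin (topology_of \<T>) A" "U = monad_real A"
    unfolding openin_hat_iff by blast
  with sub show "U \<subseteq> monad_real (topology_of \<T> interior_of X)"
    by (simp only: monad_real_subset_iff interior_of_maximal)
qed

lemma exterior_of_hat:
  "topology_of (hat_family \<T>) exterior_of (monad_real X) = monad_real (topology_of \<T> exterior_of X)"
  by (simp only: exterior_of_def topspace_hat topspace_real monad_real_Diff interior_of_hat)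

lemma closure_of_hat:
  "topology_of (hat_family \<T>) closure_of (monad_real X) = monad_real (topology_of \<T> closure_of X)"
  by (simp only: closure_of_interior_of topspace_hat topspace_real monad_real_Diff interior_of_hat)

lemma frontier_of_hat:
  "topology_of (hat_family \<T>) frontier_of (monad_real X) = monad_real (topology_of \<T> frontier_of X)"
  by (simp only: frontier_of_def closure_of_hat interior_of_hat monad_real_Diff)

section \<open>Continuity of the two maps, and compactness\<close>

lemma continuous_map_lim: "continuous_map (topology_of (hat_family \<T>)) (topology_of \<T>) lim"
proof -
  have "{x \<in> topspace (topology_of (hat_family \<T>)). lim x \<in> A} = monad_real A" for A
    unfolding topspace_hat by auto
  then show ?thesis
    by (simp add: continuous_map_def topspace_real openin_hat_monad_real)
qed

text \<open>The preimage of \<open>monad_real A\<close> under \<open>const_seq\<close> is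
  \<open>A\<close> itself, because \<open>lim\<close> undoes \<open>const_seq\<close>.\<close>

lemma continuous_map_const_seq:
  "continuous_map (topology_of \<T>) (topology_of (hat_family \<T>)) const_seq"
  by (auto simp: continuous_map_def topspace_real topspace_hat openin_hat_iff)

lemma compactin_hat_monad_real:
  "compactin (topology_of (hat_family \<T>)) (monad_real X) \<longleftrightarrow> compactin (topology_of \<T>) X"
proof
  assume "compactin (topology_of (hat_family \<T>)) (monad_real X)"
  from image_compactin[OF this continuous_map_lim] show "compactin (topology_of \<T>) X"
    by (simp only: lim_image_monad_real)
next
  assume "compactin (topology_of \<T>) X"
  \<comment> \<open>A finite subcover is first found for the constant sequences only; saturation
    then extends it to the whole monad.\<close>
  then have compact: "compactin (topology_of (hat_family \<T>)) (const_seq ` X)"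
    using continuous_map_const_seq by (rule image_compactin)
  show "compactin (topology_of (hat_family \<T>)) (monad_real X)"
    unfolding compactin_def
  proof (intro conjI allI impI)
    show "monad_real X \<subseteq> topspace (topology_of (hat_family \<T>))"
      by (simp only: topspace_hat monad_real_subset_iff subset_UNIV)
    fix \<U>
    assume "Ball \<U> (openin (topology_of (hat_family \<T>))) \<and> monad_real X \<subseteq> \<Union>\<U>"
    then have op: "\<And>U. U \<in> \<U> \<Longrightarrow> openin (topology_of (hat_family \<T>)) U"
      and cover: "monad_real X \<subseteq> \<Union>\<U>" by auto
    have "const_seq ` X \<subseteq> monad_real X" by auto
    then have "const_seq ` X \<subseteq> \<Union>\<U>" using cover by (rule subset_trans)
    with compactinD[OF compact, of \<U>] op
    obtain \<F> where \<F>: "finite \<F>" "\<F> \<subseteq> \<U>" "const_seq ` X \<subseteq> \<Union>\<F>"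
      by metis
    \<comment> \<open>The union of the subcover is open, hence a monad \<open>monad_real A\<close>.
      Containing the constant sequences over \<open>X\<close> forces \<open>X \<subseteq> A\<close>,
      so it contains all of \<open>monad_real X\<close>.\<close>
    have "openin (topology_of (hat_family \<T>)) (\<Union>\<F>)"
      using op \<F>(2) by (intro openin_Union) (rule op, rule subsetD)
    then obtain A where A: "\<Union>\<F> = monad_real A"
      unfolding openin_hat_iff by blast
    have "X \<subseteq> A"
    proof
      fix r assume "r \<in> X"
      then have "const_seq r \<in> monad_real A"
        using \<F>(3) unfolding A by blast
      then show "r \<in> A" by simp
    qed
    then have "monad_real X \<subseteq> \<Union>\<F>"
      by (simp only: A monad_real_subset_iff)
    with \<F>(1,2) show "\<exists>\<F>. finite \<F> \<and> \<F> \<subseteq> \<U> \<and> monad_real X \<subseteq> \<Union>\<F>"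
      by (intro exI conjI)
  qed
qed

section \<open>Subspaces and connectedness\<close>

lemma openin_subtopology_hat_iff:
  "openin (subtopology (topology_of (hat_family \<T>)) (monad_real X)) U \<longleftrightarrow>
    (\<exists>A. openin (subtopology (topology_of \<T>) X) A \<and> U = monad_real A)"
proof -
  have "openin (subtopology (topology_of (hat_family \<T>)) (monad_real X)) U \<longleftrightarrow>
      (\<exists>B. openin (topology_of \<T>) B \<and> U = monad_real B \<inter> monad_real X)"
    unfolding openin_subtopology openin_hat_iff by blast
  also have "\<dots> \<longleftrightarrow> (\<exists>A. openin (subtopology (topology_of \<T>) X) A \<and> U = monad_real A)"
    unfolding openin_subtopology monad_real_Int by blast
  finally show ?thesis .
qed

lemma Collect_openin_subtopology_hat:
  "{U. openin (subtopology (topology_of (hat_family \<T>)) (monad_real X)) U}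
    = hat_family {A. openin (subtopology (topology_of \<T>) X) A}"
  by (simp only: openin_subtopology_hat_iff) (auto simp only: hat_family_def mem_Collect_eq)

text \<open>A closure in a subspace is the trace of the ambient closure of the trace. Since
  \<open>Y \<subseteq> X\<close>, the inner trace is \<open>Y\<close> itself, and likewise for the
  monads.\<close>

lemma closure_of_subtopology_hat:
  assumes "Y \<subseteq> X"
  shows "subtopology (topology_of (hat_family \<T>)) (monad_real X) closure_of (monad_real Y)
    = monad_real (subtopology (topology_of \<T>) X closure_of Y)"
proof -
  have "monad_real Y \<subseteq> monad_real X"
    using assms by (simp only: monad_real_subset_iff)
  then show ?thesis
    using assms
    by (simp only: closure_of_subtopology Int_absorb1 closure_of_hat monad_real_Int)
qed

lemma connectedin_hat_monad_real:
  "connectedin (topology_of (hat_family \<T>)) (monad_real X) \<longleftrightarrow> connectedin (topology_of \<T>) X"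
proof
  assume "connectedin (topology_of (hat_family \<T>)) (monad_real X)"
  from connectedin_continuous_map_image[OF continuous_map_lim this]
  show "connectedin (topology_of \<T>) X"
    by (simp only: lim_image_monad_real)
next
  assume "connectedin (topology_of \<T>) X"
  with continuous_map_const_seq
  have "connectedin (topology_of (hat_family \<T>)) (const_seq ` X)"
    by (rule connectedin_continuous_map_image)
  moreover have "const_seq ` X \<subseteq> monad_real X" by auto
  moreover have "monad_real X \<subseteq> topology_of (hat_family \<T>) closure_of (const_seq ` X)"
  proof
    fix x assume x: "x \<in> monad_real X"
    then have "const_seq (lim x) \<in> const_seq ` X" by simp
    \<comment> \<open>Membership in an open set depends on the limit alone, so each neighbourhood of
      \<open>x\<close> meets the constant sequences at \<open>const_seq (lim x)\<close>.\<close>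
    moreover have "const_seq (lim x) \<in> U"
      if "x \<in> U" "openin (topology_of (hat_family \<T>)) U" for U
      using that by (auto simp: openin_hat_iff)
    moreover have "x \<in> topspace (topology_of (hat_family \<T>))"
      using x unfolding topspace_hat by simp
    ultimately show "x \<in> topology_of (hat_family \<T>) closure_of (const_seq ` X)"
      unfolding in_closure_of by blast
  qed
  ultimately show "connectedin (topology_of (hat_family \<T>)) (monad_real X)"
    by (rule connectedin_intermediate_closure_of)
qed

end

section \<open>Sigma-algebras\<close>

lemma sigma_algebra_hat_family:
  assumes "sigma_algebra UNIV \<B>"
  shows "sigma_algebra conv_seqs (hat_family \<B>)"
proof -
  have "hat_family \<B> = {lim -` A \<inter> conv_seqs |A. A \<in> \<B>}"
    unfolding hat_family_def monad_real_eq by blast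
  \<comment> \<open>Pulling back along \<open>lim\<close> commutes with generating a sigma-algebra,
    and \<open>\<B>\<close> already equals the one it generates; so the pulled-back family generates
    nothing new.\<close>
  also have "\<dots> = sigma_sets conv_seqs {lim -` A \<inter> conv_seqs |A. A \<in> \<B>}"
    using sigma_sets_vimage_commute[of lim conv_seqs UNIV \<B>]
    by (simp add: sigma_algebra.sigma_sets_eq[OF assms])
  finally have "hat_family \<B> = \<dots>" .
  moreover have "sigma_algebra conv_seqs \<dots>"
    by (rule sigma_algebra_sigma_sets) auto
  ultimately show ?thesis by simp
qed

theorem proposition4p7:
  shows
    "(\<forall>(X::real set) \<B>. base_for_topology X \<B> \<longrightarrow>
        base_for_topology (monad_real X) (hat_family \<B>))
     \<and>
     (\<forall>\<T>::real set set. topology_for UNIV \<T> \<longrightarrow>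
        topology_for conv_seqs (hat_family \<T>))
     \<and>
     (\<forall>(\<T>::real set set) X. topology_for UNIV \<T> \<longrightarrow>
        topology_of (hat_family \<T>) interior_of (monad_real X)
          = monad_real (topology_of \<T> interior_of X) \<and>
        topology_of (hat_family \<T>) exterior_of (monad_real X)
          = monad_real (topology_of \<T> exterior_of X) \<and>
        topology_of (hat_family \<T>) frontier_of (monad_real X)
          = monad_real (topology_of \<T> frontier_of X) \<and>
        topology_of (hat_family \<T>) closure_of (monad_real X)
          = monad_real (topology_of \<T> closure_of X) \<and>
        (openin (topology_of (hat_family \<T>)) (monad_real X) \<longleftrightarrow> openin (topology_of \<T>) X) \<and>
        (closedin (topology_of (hat_family \<T>)) (monad_real X) \<longleftrightarrow> closedin (topology_of \<T>) X) \<and>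
        (compactin (topology_of (hat_family \<T>)) (monad_real X) \<longleftrightarrow> compactin (topology_of \<T>) X))
     \<and>
     (\<forall>(\<T>::real set set) X Y. topology_for UNIV \<T> \<longrightarrow> Y \<subseteq> X \<longrightarrow>
        {U. openin (subtopology (topology_of (hat_family \<T>)) (monad_real X)) U}
          = hat_family {A. openin (subtopology (topology_of \<T>) X) A} \<and>
        subtopology (topology_of (hat_family \<T>)) (monad_real X) closure_of (monad_real Y)
          = monad_real (subtopology (topology_of \<T>) X closure_of Y))
     \<and>
     (\<forall>(\<T>::real set set) X. topology_for UNIV \<T> \<longrightarrow>
        (connectedin (topology_of (hat_family \<T>)) (monad_real X) \<longleftrightarrow>
         connectedin (topology_of \<T>) X))
     \<and>
     (\<forall>\<B>::real set set. sigma_algebra UNIV \<B> \<longrightarrow>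
        sigma_algebra conv_seqs (hat_family \<B>))"
  by (intro conjI allI impI)
    (rule base_for_topology_hat_family topology_for_conv_seqs interior_of_hat exterior_of_hat
      frontier_of_hat closure_of_hat openin_hat_monad_real closedin_hat_monad_real
      compactin_hat_monad_real Collect_openin_subtopology_hat closure_of_subtopology_hat
      connectedin_hat_monad_real sigma_algebra_hat_family; assumption)+

end
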